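(* Let $x$ be an indeterminate and work in $\mathbb Z[x][t]$. For $A\in\mathbb Z[x][t]$ with $A=a_0+a_1t+\dots$ put $\langle Z,A\rangle=xa_0-a_1$, $e(A)=\langle Z,A\rangle+tA$. For a finite rooted tree $R$ define $I(R)=1$ if $R$ is a single vertex and $I(R)=\prod_c e(I(R_c))$ otherwise, the product being over the children $c$ of the root, with $R_c$ the subtree of descendants of $c$ rooted at $c$. Then for every finite tree $T$ and every choice of root vertex producing a rooted tree $R$, $\langle Z,I(R)\rangle=\det(x\,\mathrm{Id}-A_T)$, the characteristic polynomial of the adjacency matrix $A_T$ of $T$.
   Context: This is the specialization $Z=x-t$ (i.e. $z_0=x$, $z_1=-1$, $z_i=0$ for $i\ge2$) of the construction $\langle Z,\sum b_it^i\rangle=\sum z_ib_i$. *)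

theory Defs
  imports
    "HOL-Computational_Algebra.Polynomial"
    "Jordan_Normal_Form.Char_Poly"
    "Graph_Theory.Digraph_Component"
    "Graph_Theory.Vertex_Walk"
begin

text \<open>
  The ring \<open>\<int>[x][t]\<close> is \<^typ>\<open>int poly poly\<close>: the outer variable is \<open>t\<close>, the inner one is \<open>x\<close>.
\<close>

definition Z_pairing :: "int poly poly \<Rightarrow> int poly" where
  "Z_pairing A = [:0, 1:] * coeff A 0 - coeff A 1"

definition e_op :: "int poly poly \<Rightarrow> int poly poly" where
  "e_op A = [:Z_pairing A:] + [:0, 1:] * A"

text \<open>
  A finite simple graph is a symmetric digraph in the locale \<^locale>\<open>graph\<close>, each edge being a pair
  of opposite arcs. There \<open>u, v, u\<close> counts as a cycle in the sense of \<^const>\<open>pre_digraph.cycle\<close>, so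
  the predicate \<^const>\<open>tree\<close> fails on every symmetric digraph with an arc. The cycles of the
  undirected graph are the cycles of length at least 3.
\<close>

definition undirected_tree :: "('a, 'b) pre_digraph \<Rightarrow> bool" where
  "undirected_tree G \<longleftrightarrow>
     graph G \<and> Digraph_Component.connected G \<and> \<not> (\<exists>p. pre_digraph.cycle G p \<and> 3 \<le> length p)"

definition root_children :: "('a, 'b) pre_digraph \<Rightarrow> 'a \<Rightarrow> 'a set" where
  "root_children G r = {c. (r, c) \<in> arcs_ends G}"

text \<open>
  \<open>v\<close> descends from \<open>c\<close> (possibly \<open>v = c\<close>) if the path from the root \<open>r\<close> to \<open>v\<close>, which in a tree is
  unique, passes through \<open>c\<close>.
\<close>

definition descendants :: "('a, 'b) pre_digraph \<Rightarrow> 'a \<Rightarrow> 'a \<Rightarrow> 'a set" where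
  "descendants G r c = {v. \<exists>p. vpath p G \<and> hd p = r \<and> last p = v \<and> c \<in> set p}"

definition descendant_subtree :: "('a, 'b) pre_digraph \<Rightarrow> 'a \<Rightarrow> 'a \<Rightarrow> ('a, 'b) pre_digraph" where
  "descendant_subtree G r c = G \<restriction> descendants G r c"

lemma descendants_subset: "descendants G r c \<subseteq> verts G"
  by (auto simp: descendants_def vpath_def vwalk_def)

lemma root_notin_descendants:
  assumes "c \<noteq> r"
  shows "r \<notin> descendants G r c"
proof
  assume "r \<in> descendants G r c"
  then obtain p where p: "distinct p" "p \<noteq> []" "hd p = r" "last p = r" "c \<in> set p"
    by (auto simp: descendants_def vpath_def vwalk_def)
  then have "p = [r]"
    by (cases p) (auto split: if_splits)
  with p assms show False by simp
qed

text \<open>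
  The guard makes the recursion total; it holds for every finite tree with a chosen root and is
  inherited by the subtrees of descendants.
\<close>

function tree_I :: "('a, 'b) pre_digraph \<Rightarrow> 'a \<Rightarrow> int poly poly" where
  "tree_I G r =
    (if \<not> (graph G \<and> r \<in> verts G) then undefined
     else if verts G = {r} then 1
     else (\<Prod>c \<in> root_children G r. e_op (tree_I (descendant_subtree G r c) c)))"
  by pat_completeness auto
termination
proof (relation "Wellfounded.measure (\<lambda>(G, r). card (verts G))", goal_cases)
  case 1
  show ?case by simp
next
  case (2 G r c)
  then interpret graph G by simp
  have "c \<noteq> r"
    using 2 by (auto simp: root_children_def dest: adj_not_same)
  then have "descendants G r c \<subset> verts G"
    using root_notin_descendants[of c r G] descendants_subset[of G r c] 2 by auto
  then show ?case
    by (simp add: descendant_subtree_def psubset_card_mono)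
qed

declare tree_I.simps [simp del]

lemma tree_I_guard:
  assumes "graph G" and "c \<in> root_children G r"
  shows "graph (descendant_subtree G r c)" and "c \<in> verts (descendant_subtree G r c)"
proof -
  interpret graph G by fact
  show "graph (descendant_subtree G r c)"
    unfolding descendant_subtree_def
  proof (unfold_locales, goal_cases)
    case 3
    then show ?case
      by (simp add: finite_subset[OF descendants_subset])
  next
    case 7
    then show ?case
      using sym_arcs by (fastforce simp: symmetric_conv)
  qed (auto dest: no_loops no_multi_arcs)
  have "vpath [r, c] G"
    using assms(2)
    by (auto simp: root_children_def vpath_def vwalk_def dest: adj_not_same adj_in_verts)
  then show "c \<in> verts (descendant_subtree G r c)"
    by (force simp: descendant_subtree_def descendants_def)
qed

text \<open>The adjacency matrix depends on an enumeration \<open>vs\<close> of the vertices without repetitions.\<close>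

definition adjacency_matrix :: "('a, 'b) pre_digraph \<Rightarrow> 'a list \<Rightarrow> int mat" where
  "adjacency_matrix G vs =
     mat (length vs) (length vs) (\<lambda>(i, j). if (vs ! i, vs ! j) \<in> arcs_ends G then 1 else 0)"

end

theory Submission
  imports Defs
begin

text \<open>
  By induction on the tree, \<open>\<langle>Z, I(R)\<rangle>\<close> is the characteristic polynomial of \<open>R\<close> and the constant coefficient
  of \<open>I(R)\<close> that of \<open>R\<close> without its root. Since \<open>e(A) = \<langle>Z, A\<rangle> + a\<^sub>0 t + \<dots>\<close>, multiplying by one more factor gives
  \<open>\<langle>Z, e(A) B\<rangle> = \<langle>Z, A\<rangle> \<langle>Z, B\<rangle> - a\<^sub>0 b\<^sub>0\<close>. The determinants satisfy the same recursion when a branch is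
  attached by a single edge \<open>ab\<close>: a permutation that contributes to the determinant either
  preserves both sides of the edge or swaps \<open>a\<close> and \<open>b\<close>.
\<close>

section \<open>Determinants indexed by finite sets\<close>

text \<open>
  Determinants are indexed by vertex sets, so that vertices can be deleted without re-enumerating.
\<close>

definition det_on :: "'a set \<Rightarrow> ('a \<Rightarrow> 'a \<Rightarrow> 'b) \<Rightarrow> 'b :: comm_ring_1" where
  "det_on V M = (\<Sum>p | p permutes V. of_int (sign p) * (\<Prod>i\<in>V. M i (p i)))"

lemma det_on_cong:
  assumes "\<And>i j. i \<in> V \<Longrightarrow> j \<in> V \<Longrightarrow> M i j = N i j"
  shows "det_on V M = det_on V N"
  unfolding det_on_def
  by (intro sum.cong refl arg_cong2[where f = "(*)"] prod.cong assms)
     (auto simp: permutes_in_image)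

lemma det_on_empty [simp]: "det_on {} M = 1"
  by (simp add: det_on_def)

lemma det_on_singleton [simp]: "det_on {a} M = M a a"
  by (simp add: det_on_def)

text \<open>Transporting permutations of positions along the enumeration is a bijection onto the
  permutations of \<open>set vs\<close> and preserves signs, so the two Leibniz sums agree term by
  term.\<close>

lemma det_on_set_eq_det:
  assumes "distinct vs"
  shows "det_on (set vs) M = det (mat (length vs) (length vs) (\<lambda>(i, j). M (vs ! i) (vs ! j)))"
proof -
  let ?n = "length vs" and ?f = "(!) vs"
  have bij: "bij_betw ?f {0..<?n} (set vs)"
    using bij_betw_nth[OF assms] by (simp add: atLeast0LessThan)
  then have inj: "inj_on ?f {0..<?n}" and img: "?f ` {0..<?n} = set vs"
    by (auto simp: bij_betw_def)
  have perms: "bij_betw (map_permutation {0..<?n} ?f) {p. p permutes {0..<?n}} {p. p permutes set vs}"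
    using bij_betw_permutations[OF bij] img
    by (simp add: map_permutation_def[abs_def] restrict_id_def o_def)
  have "det_on (set vs) M = (\<Sum>p | p permutes {0..<?n}.
      of_int (sign (map_permutation {0..<?n} ?f p)) *
      (\<Prod>v\<in>set vs. M v (map_permutation {0..<?n} ?f p v)))"
    unfolding det_on_def by (rule sum.reindex_bij_betw[OF perms, symmetric])
  also have "\<dots> = (\<Sum>p | p permutes {0..<?n}.
      of_int (sign p) * (\<Prod>i = 0..<?n. M (vs ! i) (vs ! p i)))"
  proof (rule sum.cong, goal_cases)
    case (2 p)
    then have p: "p permutes {0..<?n}" by simp
    have "(\<Prod>v\<in>set vs. M v (map_permutation {0..<?n} ?f p v)) =
        (\<Prod>i = 0..<?n. M (vs ! i) (map_permutation {0..<?n} ?f p (vs ! i)))"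
      by (rule prod.reindex_bij_betw[OF bij, symmetric])
    also have "\<dots> = (\<Prod>i = 0..<?n. M (vs ! i) (vs ! p i))"
      by (rule prod.cong) (auto simp: map_permutation_apply[OF inj])
    finally show ?case
      using sign_map_permutation[OF inj p] by simp
  qed simp
  also have "\<dots> = det (mat ?n ?n (\<lambda>(i, j). M (vs ! i) (vs ! j)))"
    by (subst det_def'[of _ ?n])
       (auto intro!: sum.cong prod.cong arg_cong2[where f = "(*)"] dest: permutes_in_image)
  finally show ?thesis .
qed

section \<open>Determinants along blocks and bridges\<close>

text \<open>A permutation of the union that maps \<open>A\<close> into itself is uniquely a
  permutation of \<open>A\<close> composed with one of \<open>B\<close>; both sign and product of
  entries are multiplicative under this decomposition.\<close>

lemma sum_permutes_stabilizing:
  assumes fin: "finite A" "finite B" and disj: "A \<inter> B = {}"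
  shows "(\<Sum>p | p permutes A \<union> B \<and> p ` A \<subseteq> A. of_int (sign p) * (\<Prod>i\<in>A \<union> B. M i (p i)))
       = det_on A M * det_on B M"
proof -
  let ?t = "\<lambda>S p. of_int (sign p) * (\<Prod>i\<in>S. M i (p i))"
  have "det_on A M * det_on B M
      = (\<Sum>(p, q)\<in>{p. p permutes A} \<times> {q. q permutes B}. ?t A p * ?t B q)"
    unfolding det_on_def by (simp add: sum_product sum.cartesian_product)
  also have "\<dots> = (\<Sum>p | p permutes A \<union> B \<and> p ` A \<subseteq> A. ?t (A \<union> B) p)"
  proof (rule sum.reindex_bij_witness[where j = "\<lambda>(p, q). p \<circ> q"
        and i = "\<lambda>p. (restrict_id p A, restrict_id p B)"], goal_cases)
    case (1 pq)
    then obtain p q where pq: "pq = (p, q)" "p permutes A" "q permutes B" by auto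
    have "restrict_id (p \<circ> q) A = p"
      using disj[unfolded disjoint_iff] permutes_not_in[OF pq(2)] permutes_not_in[OF pq(3)]
      by (auto simp: restrict_id_def fun_eq_iff)
    moreover have "restrict_id (p \<circ> q) B = q"
      using disj permutes_not_in[OF pq(2)] permutes_not_in[OF pq(3)] permutes_in_image[OF pq(3)]
      by (auto simp: restrict_id_def fun_eq_iff)
    ultimately show ?case by (simp add: pq)
  next
    case (2 pq)
    then obtain p q where pq: "pq = (p, q)" "p permutes A" "q permutes B" by auto
    have "p \<circ> q permutes A \<union> B"
      using pq by (auto intro!: permutes_compose intro: permutes_subset)
    moreover have "(p \<circ> q) ` A \<subseteq> A"
      using disj permutes_not_in[OF pq(3)] permutes_in_image[OF pq(2)] by fastforce
    ultimately show ?case by (simp add: pq)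
  next
    case (3 p)
    then have p: "p permutes A \<union> B" "p ` A \<subseteq> A" by auto
    \<comment> \<open>Finiteness and injectivity turn the inclusion into equality, so
      \<open>p\<close> maps \<open>B\<close> into \<open>B\<close> as well.\<close>
    have imgA: "p ` A = A"
      using p fin by (intro endo_inj_surj) (auto intro: permutes_inj_on)
    then have "p x \<in> B" if "x \<in> B" for x
      using that disj permutes_inj[OF p(1)] permutes_in_image[OF p(1), of x]
      by (auto simp: inj_image_mem_iff dest: injD)
    then show ?case
      using permutes_not_in[OF p(1)] disj by (auto simp: restrict_id_def fun_eq_iff)
  next
    case (4 p)
    then have p: "p permutes A \<union> B" "p ` A \<subseteq> A" by auto
    have imgA: "p ` A = A"
      using p fin by (intro endo_inj_surj) (auto intro: permutes_inj_on)
    have "p ` B = p ` (A \<union> B) - p ` A"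
      using disj by (subst image_set_diff[OF permutes_inj[OF p(1)], symmetric])
         (auto intro!: arg_cong[where f = "(`) p"])
    then have imgB: "p ` B = B"
      using disj imgA permutes_image[OF p(1)] by auto
    show ?case
      using imgA imgB permutes_inj_on[OF p(1)]
      by (auto intro!: permutes_restrict_id simp: bij_betw_def)
  next
    case (5 pq)
    then obtain p q where pq: "pq = (p, q)" "p permutes A" "q permutes B" by auto
    have "permutation p" "permutation q"
      using pq fin by (auto simp: permutation_permutes)
    then have "sign (p \<circ> q) = sign p * sign q" by (rule sign_compose)
    moreover have "(\<Prod>i\<in>A \<union> B. M i ((p \<circ> q) i)) = (\<Prod>i\<in>A. M i (p i)) * (\<Prod>i\<in>B. M i (q i))"
    proof (subst prod.union_disjoint[OF fin disj], rule arg_cong2[where f = "(*)"])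
      show "(\<Prod>i\<in>A. M i ((p \<circ> q) i)) = (\<Prod>i\<in>A. M i (p i))"
        using disj[unfolded disjoint_iff] permutes_not_in[OF pq(3)] by (intro prod.cong) auto
      have "p (q i) = q i" if "i \<in> B" for i
        using that disj permutes_not_in[OF pq(2)] permutes_in_image[OF pq(3)] by blast
      then show "(\<Prod>i\<in>B. M i ((p \<circ> q) i)) = (\<Prod>i\<in>B. M i (q i))"
        by (intro prod.cong) auto
    qed
    ultimately show ?case by (simp add: pq algebra_simps)
  qed
  finally show ?thesis ..
qed

text \<open>A permutation that moves some point of \<open>A\<close> into \<open>B\<close> picks an
  entry from the zero block, so only the stabilizing ones contribute.\<close>

lemma det_on_block_triangular:
  assumes fin: "finite A" "finite B" and disj: "A \<inter> B = {}"
    and zero: "\<And>a b. a \<in> A \<Longrightarrow> b \<in> B \<Longrightarrow> M a b = 0"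
  shows "det_on (A \<union> B) M = det_on A M * det_on B M"
proof -
  let ?t = "\<lambda>p. of_int (sign p) * (\<Prod>i\<in>A \<union> B. M i (p i))"
  have "det_on (A \<union> B) M = (\<Sum>p | p permutes A \<union> B \<and> p ` A \<subseteq> A. ?t p)"
    unfolding det_on_def
  proof (rule sum.mono_neutral_right)
    show "\<forall>p\<in>{p. p permutes A \<union> B} - {p. p permutes A \<union> B \<and> p ` A \<subseteq> A}. ?t p = 0"
    proof
      fix p assume "p \<in> {p. p permutes A \<union> B} - {p. p permutes A \<union> B \<and> p ` A \<subseteq> A}"
      then obtain i where "i \<in> A" "p i \<in> B"
        by (auto dest: permutes_in_image)
      then have "\<exists>i\<in>A \<union> B. M i (p i) = 0" using zero by blast
      then show "?t p = 0" using fin by (metis finite_UnI mult_zero_right prod_zero)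
    qed
  qed (use fin in \<open>auto intro: finite_permutations\<close>)
  then show ?thesis using sum_permutes_stabilizing[OF fin disj] by simp
qed

text \<open>Composing with the transposition of \<open>a\<close> and \<open>b\<close> identifies
  these permutations with those of \<open>V - {a, b}\<close> and reverses the sign.\<close>

lemma sum_permutes_swapping:
  assumes fin: "finite V" and ab: "a \<in> V" "b \<in> V" "a \<noteq> b"
  shows "(\<Sum>p | p permutes V \<and> p a = b \<and> p b = a. of_int (sign p) * (\<Prod>i\<in>V. M i (p i)))
       = - (M a b * M b a * det_on (V - {a, b}) M)"
proof -
  let ?s = "Transposition.transpose a b"
  have "- (M a b * M b a * det_on (V - {a, b}) M)
      = (\<Sum>p | p permutes V - {a, b}.
          - (M a b * M b a * (of_int (sign p) * (\<Prod>i\<in>V - {a, b}. M i (p i)))))"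
    by (simp add: det_on_def sum_distrib_left sum_negf)
  also have "\<dots> = (\<Sum>p | p permutes V \<and> p a = b \<and> p b = a.
      of_int (sign p) * (\<Prod>i\<in>V. M i (p i)))"
  proof (rule sum.reindex_bij_witness[where j = "\<lambda>p. p \<circ> ?s" and i = "\<lambda>p. p \<circ> ?s"], goal_cases)
    case (1 p)
    show ?case by (simp add: o_assoc [symmetric])
  next
    case (2 p)
    then have p: "p permutes V - {a, b}" by simp
    then have "p permutes V" by (auto intro: permutes_subset)
    then have "p \<circ> ?s permutes V"
      using ab by (intro permutes_compose permutes_swap_id)
    then show ?case using permutes_not_in[OF p] by simp
  next
    case (3 p)
    show ?case by (simp add: o_assoc [symmetric])
  next
    case (4 p)
    then have p: "p permutes V" "p a = b" "p b = a" by auto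
    have "p \<circ> ?s permutes V"
      using p ab by (intro permutes_compose permutes_swap_id)
    then have "p \<circ> ?s permutes V - {a, b}"
      by (rule permutes_superset) (use p in auto)
    then show ?case by simp
  next
    case (5 p)
    then have p: "p permutes V - {a, b}" by simp
    then have "permutation p" using fin by (auto simp: permutation_permutes)
    then have sgn: "sign (p \<circ> ?s) = - sign p"
      using ab by (simp add: sign_compose permutation_swap_id sign_swap_id)
    have "V = insert a (insert b (V - {a, b}))" using ab by auto
    then have "(\<Prod>i\<in>V. M i ((p \<circ> ?s) i)) =
        (\<Prod>i\<in>insert a (insert b (V - {a, b})). M i ((p \<circ> ?s) i))" by simp
    \<comment> \<open>Since \<open>p\<close> fixes \<open>a\<close> and \<open>b\<close>, the two
      leading factors are \<open>M a b\<close> and \<open>M b a\<close>.\<close>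
    also have "\<dots> = M a (p b) * (M b (p a) * (\<Prod>i\<in>V - {a, b}. M i ((p \<circ> ?s) i)))"
      using fin ab by simp
    also have "(\<Prod>i\<in>V - {a, b}. M i ((p \<circ> ?s) i)) = (\<Prod>i\<in>V - {a, b}. M i (p i))"
      by (rule prod.cong) auto
    finally show ?case using sgn permutes_not_in[OF p] by (simp add: algebra_simps)
  qed
  finally show ?thesis ..
qed

text \<open>The only possibly nonzero entries between the sides are at \<open>(a, b)\<close> and
  \<open>(b, a)\<close>. A contributing permutation that leaves \<open>A\<close> must therefore send
  \<open>a\<close> to \<open>b\<close>, and something must come back, which is possible only from
  \<open>b\<close> to \<open>a\<close>.\<close>

lemma det_on_bridge:
  assumes fin: "finite A" "finite B" and disj: "A \<inter> B = {}" and ab: "a \<in> A" "b \<in> B"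
    and AB: "\<And>i j. i \<in> A \<Longrightarrow> j \<in> B \<Longrightarrow> (i, j) \<noteq> (a, b) \<Longrightarrow> M i j = 0"
    and BA: "\<And>i j. i \<in> A \<Longrightarrow> j \<in> B \<Longrightarrow> (i, j) \<noteq> (a, b) \<Longrightarrow> M j i = 0"
  shows "det_on (A \<union> B) M =
    det_on A M * det_on B M - M a b * M b a * det_on (A - {a}) M * det_on (B - {b}) M"
proof -
  let ?t = "\<lambda>p. of_int (sign p) * (\<Prod>i\<in>A \<union> B. M i (p i))"
  let ?P = "{p. p permutes A \<union> B \<and> p ` A \<subseteq> A}"
  let ?Q = "{p. p permutes A \<union> B \<and> p a = b \<and> p b = a}"
  have "det_on (A \<union> B) M = sum ?t (?P \<union> ?Q)"
    unfolding det_on_def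
  proof (rule sum.mono_neutral_right)
    show "\<forall>p\<in>{p. p permutes A \<union> B} - (?P \<union> ?Q). ?t p = 0"
    proof (rule ballI, rule ccontr)
      fix p assume "p \<in> {p. p permutes A \<union> B} - (?P \<union> ?Q)" and nz: "?t p \<noteq> 0"
      then have p: "p permutes A \<union> B" "\<not> p ` A \<subseteq> A" "\<not> (p a = b \<and> p b = a)" by auto
      have nonzero: "M i (p i) \<noteq> 0" if "i \<in> A \<union> B" for i
        using nz that fin by (metis finite_UnI mult_zero_right prod_zero)
      obtain i where "i \<in> A" "p i \<in> B"
        using p(1,2) by (auto dest: permutes_in_image)
      with AB nonzero have pab: "p a = b" by (metis Pair_inject UnI1)
      \<comment> \<open>Otherwise \<open>b\<close> would already be the image of a point of
        \<open>B\<close>, in conflict with \<open>p a = b\<close> and injectivity.\<close>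
      have "\<not> p ` B \<subseteq> B"
      proof
        assume "p ` B \<subseteq> B"
        then have "p ` B = B"
          using fin by (intro endo_inj_surj permutes_inj_on[OF p(1)])
        then obtain j where "j \<in> B" "p j = b" using ab by (metis imageE)
        with pab permutes_inj[OF p(1)] have "a \<in> B" by (metis injD)
        with ab disj show False by blast
      qed
      then obtain j where "j \<in> B" "p j \<in> A"
        using p(1) by (auto dest: permutes_in_image)
      with BA nonzero have "p b = a" by (metis Pair_inject UnI2)
      with pab p show False by simp
    qed
  qed (use fin in \<open>auto intro: finite_permutations\<close>)
  also have "\<dots> = sum ?t ?P + sum ?t ?Q"
    by (rule sum.union_disjoint)
       (use fin disj ab in \<open>auto intro!: finite_subset[OF _ finite_permutations[of "A \<union> B"]]\<close>)
  also have "sum ?t ?P = det_on A M * det_on B M"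
    by (rule sum_permutes_stabilizing[OF fin disj])
  also have "sum ?t ?Q = - (M a b * M b a * det_on (A \<union> B - {a, b}) M)"
    by (rule sum_permutes_swapping) (use fin ab disj in auto)
  also have "A \<union> B - {a, b} = (A - {a}) \<union> (B - {b})"
    using ab disj by auto
  \<comment> \<open>With \<open>a\<close> and \<open>b\<close> deleted, no nonzero entry leads from
    the first side to the second.\<close>
  also have "det_on \<dots> M = det_on (A - {a}) M * det_on (B - {b}) M"
    by (rule det_on_block_triangular) (use fin disj AB in auto)
  finally show ?thesis by (simp add: algebra_simps)
qed


section \<open>The characteristic polynomial of a graph\<close>

text \<open>These are the entries of the matrix x Id - A with rows and columns named by vertices.
  Putting \<open>[:0, 1:]\<close> on the whole diagonal is correct because the graphs considered
  have no loops.\<close>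

definition char_entry :: "('a \<times> 'a) set \<Rightarrow> 'a \<Rightarrow> 'a \<Rightarrow> int poly" where
  "char_entry E u v = (if u = v then [:0, 1:] else if (u, v) \<in> E then - 1 else 0)"

lemma char_poly_adjacency_matrix:
  assumes "graph G" "distinct vs" "set vs = verts G"
  shows "char_poly (adjacency_matrix G vs) = det_on (verts G) (char_entry (arcs_ends G))"
proof -
  interpret graph G by fact
  have "char_poly_matrix (adjacency_matrix G vs) =
      mat (length vs) (length vs) (\<lambda>(i, j). char_entry (arcs_ends G) (vs ! i) (vs ! j))"
    using assms(2)
    by (intro eq_matI)
       (auto simp: char_poly_matrix_def adjacency_matrix_def char_entry_def nth_eq_iff_index_eq
         one_pCons dest: adj_not_same)
  then show ?thesis
    using det_on_set_eq_det[OF assms(2)] assms(3) by (metis char_poly_def)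
qed

section \<open>The pairing of a product over branches\<close>

lemma coeff_0_e_op [simp]: "coeff (e_op A) 0 = Z_pairing A"
  and coeff_1_e_op [simp]: "coeff (e_op A) (Suc 0) = coeff A 0"
  by (simp_all add: e_op_def coeff_pCons)

text \<open>The pairing sees only the two lowest coefficients in t, and those of
  \<open>e_op A\<close> are \<open>Z_pairing A\<close> and \<open>coeff A 0\<close>. The result has
  the shape of \<open>det_on_bridge\<close> with both bridge entries equal to -1.\<close>

lemma Z_pairing_mult_e_op:
  "Z_pairing (e_op A * B) = Z_pairing B * Z_pairing A - coeff B 0 * coeff A 0"
proof -
  have "Z_pairing (e_op A * B) = [:0, 1:] * (Z_pairing A * coeff B 0)
      - (Z_pairing A * coeff B 1 + coeff A 0 * coeff B 0)"
    by (simp add: Z_pairing_def[of "e_op A * B"] coeff_mult)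
  then show ?thesis
    by (simp add: Z_pairing_def[of B] algebra_simps del: mult_pCons_left mult_pCons_right)
qed

text \<open>The branches are attached to \<open>r\<close> one at a time. Each new branch
  \<open>D c\<close> is joined to what is already built by the single edge between \<open>r\<close>
  and \<open>c\<close>, so \<open>det_on_bridge\<close> matches \<open>Z_pairing_mult_e_op\<close>;
  without \<open>r\<close> the branches are independent blocks.\<close>

lemma star_of_branches:
  assumes "finite C"
    and fin: "\<And>c. c \<in> C \<Longrightarrow> finite (D c)"
    and self: "\<And>c. c \<in> C \<Longrightarrow> c \<in> D c"
    and not_root: "\<And>c. c \<in> C \<Longrightarrow> r \<notin> D c"
    and disj: "\<And>c d. c \<in> C \<Longrightarrow> d \<in> C \<Longrightarrow> c \<noteq> d \<Longrightarrow> D c \<inter> D d = {}"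
    and across: "\<And>c d u v. c \<in> C \<Longrightarrow> d \<in> C \<Longrightarrow> c \<noteq> d \<Longrightarrow> u \<in> D c \<Longrightarrow> v \<in> D d \<Longrightarrow> M u v = 0"
    and far: "\<And>c v. c \<in> C \<Longrightarrow> v \<in> D c \<Longrightarrow> v \<noteq> c \<Longrightarrow> M r v = 0 \<and> M v r = 0"
    and near: "\<And>c. c \<in> C \<Longrightarrow> M r c = - 1 \<and> M c r = - 1"
    and diag: "M r r = [:0, 1:]"
    and branch: "\<And>c. c \<in> C \<Longrightarrow> Z_pairing (F c) = det_on (D c) M"
      "\<And>c. c \<in> C \<Longrightarrow> coeff (F c) 0 = det_on (D c - {c}) M"
  shows "Z_pairing (\<Prod>c\<in>C. e_op (F c)) = det_on (insert r (\<Union>c\<in>C. D c)) M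
       \<and> coeff (\<Prod>c\<in>C. e_op (F c)) 0 = det_on (\<Union>c\<in>C. D c) M"
proof -
  have "Z_pairing (\<Prod>c\<in>S. e_op (F c)) = det_on (insert r (\<Union>c\<in>S. D c)) M
      \<and> coeff (\<Prod>c\<in>S. e_op (F c)) 0 = det_on (\<Union>c\<in>S. D c) M" if "S \<subseteq> C" for S
    using finite_subset[OF that \<open>finite C\<close>] that
  proof (induction S rule: finite_induct)
    case empty
    \<comment> \<open>The empty product 1 pairs to x, the determinant of the lone root, and has
      constant coefficient 1, the determinant over the empty set.\<close>
    then show ?case by (simp add: Z_pairing_def diag)
  next
    case (insert c S)
    let ?P = "\<Prod>c\<in>S. e_op (F c)" and ?U = "\<Union>c\<in>S. D c"
    have IH: "Z_pairing ?P = det_on (insert r ?U) M" "coeff ?P 0 = det_on ?U M"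
      using insert by auto
    have c: "c \<in> C" and S: "S \<subseteq> C" using insert.prems by auto
    have ne: "d \<noteq> c" if "d \<in> S" for d using that insert.hyps by auto
    have finU: "finite ?U" using insert.hyps S fin by auto
    have rU: "r \<notin> ?U" using S not_root by blast
    have UD: "?U \<inter> D c = {}" using disj c S ne by blast
    have zero: "M u v = 0" "M v u = 0" if "u \<in> ?U" "v \<in> D c" for u v
      using that across c S ne by blast+
    have "det_on (insert r ?U \<union> D c) M
        = det_on (insert r ?U) M * det_on (D c) M
          - M r c * M c r * det_on (insert r ?U - {r}) M * det_on (D c - {c}) M"
    proof (rule det_on_bridge)
      show "insert r ?U \<inter> D c = {}" using UD not_root[OF c] by blast
      show "M i j = 0" "M j i = 0" if "i \<in> insert r ?U" "j \<in> D c" "(i, j) \<noteq> (r, c)" for i j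
        using that zero far[OF c] by blast+
    qed (use finU fin[OF c] self[OF c] in auto)
    also have "insert r ?U - {r} = ?U" using rU by simp
    also have "M r c * M c r = 1" using near[OF c] by simp
    finally have "det_on (insert r ?U \<union> D c) M = Z_pairing (e_op (F c) * ?P)"
      using IH branch[OF c] by (simp add: Z_pairing_mult_e_op)
    moreover have "coeff (e_op (F c) * ?P) 0 = det_on (?U \<union> D c) M"
      using det_on_block_triangular[OF finU fin[OF c] UD zero(1)] IH branch[OF c]
      by (simp add: coeff_mult mult.commute)
    ultimately show ?case
      using insert.hyps by (simp add: Un_commute)
  qed
  then show ?thesis by blast
qed

section \<open>Acyclicity, walks and descendants\<close>

text \<open>
  Acyclicity in the only form needed: two distinct neighbours of a vertex cannot be joined by a walk
  that avoids it. This passes to subgraphs by monotonicity.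
\<close>

definition unique_branches :: "('a \<times> 'a) set \<Rightarrow> bool" where
  "unique_branches E \<longleftrightarrow>
     (\<forall>r c d. (r, c) \<in> E \<longrightarrow> (r, d) \<in> E \<longrightarrow> (c, d) \<in> (Restr E (- {r}))\<^sup>* \<longrightarrow> c = d)"

lemma unique_branchesD:
  assumes "unique_branches E" "(r, c) \<in> E" "(r, d) \<in> E" "(c, d) \<in> (Restr E (- {r}))\<^sup>*"
  shows "c = d"
  using assms unfolding unique_branches_def by blast

lemma unique_branches_subset:
  assumes "unique_branches E" "E' \<subseteq> E"
  shows "unique_branches E'"
proof -
  have "(Restr E' (- {r}))\<^sup>* \<subseteq> (Restr E (- {r}))\<^sup>*" for r
    using assms(2) by (intro rtrancl_mono) auto
  then show ?thesis
    using assms unfolding unique_branches_def by blast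
qed

text \<open>\<open>cycle\<close> is about arc walks while \<open>descendants\<close> uses vertex
  walks; this leads from the latter to the former.\<close>

lemma (in wf_digraph) vwalk_imp_awalk:
  assumes "vwalk p G"
  obtains es where "awalk (hd p) es (last p)" "awalk_verts (hd p) es = p"
proof -
  have "\<exists>es. awalk (hd p) es (last p) \<and> awalk_verts (hd p) es = p"
    using assms
  proof (induction p rule: vwalk_induct)
    case (Base u)
    then show ?case by (intro exI[of _ "[]"]) (simp add: awalk_Nil_iff)
  next
    case (Cons u v ps)
    then obtain es where "awalk v es (last (v # ps))" "awalk_verts v es = v # ps" by auto
    moreover from Cons obtain e where "e \<in> arcs G" "tail G e = u" "head G e = v" by auto
    ultimately show ?case by (intro exI[of _ "e # es"]) (auto simp: awalk_Cons_iff)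
  qed
  then show ?thesis using that by blast
qed

text \<open>The chain of arcs is a walk off \<open>r\<close>. Shortening it to a path introduces no
  new vertices, so \<open>r\<close> is still avoided.\<close>

lemma (in wf_digraph) avoiding_imp_vpath:
  assumes "(u, v) \<in> (Restr (arcs_ends G) (- {r}))\<^sup>*" "u \<in> verts G" "u \<noteq> r"
  obtains p where "vpath p G" "hd p = u" "last p = v" "r \<notin> set p"
proof -
  have "\<exists>p. vwalk p G \<and> hd p = u \<and> last p = v \<and> r \<notin> set p"
    using assms
  proof (induction rule: converse_rtrancl_induct)
    case base
    then show ?case by (intro exI[of _ "[v]"]) auto
  next
    case (step u w)
    then have "w \<in> verts G" "w \<noteq> r" by (auto dest: adj_in_verts)
    with step obtain p where p: "vwalk p G" "hd p = w" "last p = v" "r \<notin> set p" by blast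
    with step have "vwalk (u # p) G" by (intro vwalk_wf_digraph_consI) auto
    with p step show ?case by (intro exI[of _ "u # p"]) (auto simp: vwalk_def)
  qed
  then obtain p where "vwalk p G" "hd p = u" "last p = v" "r \<notin> set p" by blast
  then show ?thesis
    using that[of "vwalk_to_vpath p"] vwalk_to_vpath_vpath vwalk_to_vpath_subset
    by (fastforce simp: vwalk_to_vpath_hd vwalk_to_vpath_last)
qed

text \<open>Every vertex of the walk is covered, not only the last, because a child may occur
  anywhere on the path in \<open>descendants\<close>.\<close>

lemma vwalk_imp_avoiding:
  assumes "vwalk p G" "r \<notin> set p" "v \<in> set p"
  shows "(hd p, v) \<in> (Restr (arcs_ends G) (- {r}))\<^sup>*"
  using assms
proof (induction p rule: vwalk_induct)
  case (Cons u w ps)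
  then have "(u, w) \<in> Restr (arcs_ends G) (- {r})" by auto
  with Cons show ?case by (auto intro: converse_rtrancl_into_rtrancl)
qed simp

text \<open>A path from \<open>c\<close> to \<open>d\<close> off \<open>r\<close> closes up through
  \<open>r\<close> to a cycle.\<close>

lemma undirected_tree_unique_branches:
  assumes "undirected_tree G"
  shows "unique_branches (arcs_ends G)"
  unfolding unique_branches_def
proof (intro allI impI, rule ccontr)
  fix r c d
  assume rc: "(r, c) \<in> arcs_ends G" and rd: "(r, d) \<in> arcs_ends G"
    and cd: "(c, d) \<in> (Restr (arcs_ends G) (- {r}))\<^sup>*" and "c \<noteq> d"
  interpret graph G using assms by (simp add: undirected_tree_def)
  have c: "c \<in> verts G" "c \<noteq> r" using rc by (auto dest: adj_not_same)
  from avoiding_imp_vpath[OF cd c]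
  obtain p where p: "vpath p G" "hd p = c" "last p = d" "r \<notin> set p" .
  have dr: "(d, r) \<in> arcs_ends G" using rd by (rule arcs_ends_symmetric[OF sym_arcs])
  have ne: "p \<noteq> []" using p by auto
  have "vwalk (p @ [r]) G"
    using p ne dr rc by (auto simp: vpath_def vwalk_def set_vwalk_arcs_snoc)
  then have "vwalk (r # p @ [r]) G"
    using ne p rc by (intro vwalk_wf_digraph_consI) auto
  then obtain es where es: "awalk r es r" "awalk_verts r es = r # p @ [r]"
    by (rule vwalk_imp_awalk) simp
  have "length p \<ge> 2"
    using ne p \<open>c \<noteq> d\<close> by (cases p; cases "tl p") auto
  \<comment> \<open>The closed walk has one arc more than \<open>p\<close> has vertices, and
    \<open>p\<close> has at least two because its ends differ. So it is not a mere back-and-forth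
    along one edge.\<close>
  then have len: "3 \<le> length es"
    using arg_cong[OF es(2), of length] by (simp add: length_awalk_verts)
  then have "cycle es"
    unfolding cycle_def using es p by (intro exI[of _ r]) (auto simp: vpath_def)
  with len assms show False by (auto simp: undirected_tree_def)
qed

text \<open>\<open>connected\<close> refers to the symmetrized digraph, which has the same
  reachability when the arcs are already symmetric.\<close>

lemma undirected_tree_reachable:
  assumes "undirected_tree G" "u \<in> verts G" "v \<in> verts G"
  shows "(u, v) \<in> (arcs_ends G)\<^sup>*"
proof -
  interpret graph G using assms by (simp add: undirected_tree_def)
  have "u \<rightarrow>\<^sup>*\<^bsub>with_proj (mk_symmetric G)\<^esub> v"
    using assms by (auto simp: undirected_tree_def Digraph_Component.connected_def strongly_connected_def)
  then have "u \<rightarrow>\<^sup>*\<^bsub>G\<^esub> v" by (simp add: reachable_mk_symmetric_eq[OF sym_arcs])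
  then show ?thesis by (simp add: reachable_def rtrancl_on_rtranclI)
qed

text \<open>A path from \<open>r\<close> through \<open>c\<close> continues off \<open>r\<close>
  after its first step to some neighbour \<open>d\<close>; this joins \<open>d\<close> to
  \<open>c\<close>, so \<open>d = c\<close> by unique branches. Descendants thus become a
  reachability class off \<open>r\<close>, which is easier to handle than paths.\<close>

lemma descendants_eq_avoiding:
  assumes "graph G" "unique_branches (arcs_ends G)" and c: "c \<in> root_children G r"
  shows "descendants G r c = (Restr (arcs_ends G) (- {r}))\<^sup>* `` {c}"
proof -
  interpret graph G by fact
  have rc: "(r, c) \<in> arcs_ends G" using c by (simp add: root_children_def)
  then have cr: "c \<in> verts G" "c \<noteq> r" by (auto dest: adj_not_same)
  show ?thesis
  proof (intro equalityI subsetI)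
    fix v assume "v \<in> descendants G r c"
    then obtain p where p: "vpath p G" "hd p = r" "last p = v" "c \<in> set p"
      by (auto simp: descendants_def)
    then obtain d q where q: "p = r # d # q"
      using cr by (cases p; cases "tl p") auto
    have rd: "(r, d) \<in> arcs_ends G" and walk: "vwalk (d # q) G" and "r \<notin> set (d # q)"
      using p q by (auto simp: vpath_def vwalk_def)
    note reach = vwalk_imp_avoiding[OF walk \<open>r \<notin> set (d # q)\<close>, simplified list.sel]
    have "c \<in> set (d # q)" using p q cr by auto
    then have "d = c" using reach unique_branchesD[OF assms(2) rd rc] by blast
    moreover have "v \<in> set (d # q)" using p q by auto
    ultimately show "v \<in> (Restr (arcs_ends G) (- {r}))\<^sup>* `` {c}" using reach by blast
  next
    fix v assume "v \<in> (Restr (arcs_ends G) (- {r}))\<^sup>* `` {c}"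
    then have "(c, v) \<in> (Restr (arcs_ends G) (- {r}))\<^sup>*" by simp
    from avoiding_imp_vpath[OF this cr]
    obtain p where p: "vpath p G" "hd p = c" "last p = v" "r \<notin> set p" .
    have ne: "p \<noteq> []" using p by auto
    have "vwalk (r # p) G"
      using p rc by (intro vwalk_wf_digraph_consI) auto
    then have "vpath (r # p) G" using p by (simp add: vpath_def)
    moreover have "c \<in> set p" using ne p by auto
    ultimately show "v \<in> descendants G r c"
      using p ne unfolding descendants_def by (intro CollectI exI[of _ "r # p"]) auto
  qed
qed

section \<open>Induction on the rooted tree\<close>

lemma arcs_ends_induce: "arcs_ends (G \<restriction> S) = Restr (arcs_ends G) S"
  by (auto simp: arcs_ends_conv)

text \<open>Both claims are proved together because the product rule for the pairing involves
  constant coefficients. The hypotheses are a form of being a tree that passes readily to the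
  subtrees of descendants.\<close>

lemma tree_I_eq_det_on:
  assumes "graph G" "unique_branches (arcs_ends G)" "r \<in> verts G"
    and "\<And>v. v \<in> verts G \<Longrightarrow> (r, v) \<in> (arcs_ends G)\<^sup>*"
  shows "Z_pairing (tree_I G r) = det_on (verts G) (char_entry (arcs_ends G))
       \<and> coeff (tree_I G r) 0 = det_on (verts G - {r}) (char_entry (arcs_ends G))"
  using assms
proof (induction G r rule: tree_I.induct)
  case (1 G r)
  interpret graph G by fact
  let ?E = "arcs_ends G" and ?C = "root_children G r" and ?D = "descendants G r"
  let ?R = "(Restr ?E (- {r}))\<^sup>*"
  note desc = descendants_eq_avoiding[OF 1(2,3)]
  have child: "(r, c) \<in> ?E" "(c, r) \<in> ?E" "c \<noteq> r" if "c \<in> ?C" for c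
    using that arcs_ends_symmetric[OF sym_arcs] by (auto simp: root_children_def dest: adj_not_same)
  have R_sym: "(v, u) \<in> ?R" if "(u, v) \<in> ?R" for u v
  proof -
    have "sym (Restr ?E (- {r}))"
      using arcs_ends_symmetric[OF sym_arcs] by (auto intro!: symI)
    then show ?thesis using that by (meson sym_rtrancl symD)
  qed
  have D_not_root: "r \<notin> ?D c" if "c \<in> ?C" for c
    using root_notin_descendants child(3)[OF that] by metis
  have D_self: "c \<in> ?D c" if "c \<in> ?C" for c
    using desc[OF that] by simp
  \<comment> \<open>With \<open>u = v\<close> this makes distinct branches disjoint; with an arc
    from \<open>u\<close> to \<open>v\<close> it excludes edges between them.\<close>
  have D_same: "c = d" if "c \<in> ?C" "d \<in> ?C" "u \<in> ?D c" "v \<in> ?D d" "(u, v) \<in> ?R" for c d u v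
  proof -
    have "(c, u) \<in> ?R" "(v, d) \<in> ?R"
      using that desc[OF that(1)] desc[OF that(2)] by (auto intro: R_sym)
    then have "(c, d) \<in> ?R" using that(5) by auto
    then show ?thesis using unique_branchesD[OF 1(3)] child(1) that by blast
  qed
  have D_closed: "v \<in> ?D c" if "c \<in> ?C" "u \<in> ?D c" "(u, v) \<in> Restr ?E (- {r})" for c u v
    using that desc[OF that(1)] by (auto intro: rtrancl_into_rtrancl)
  \<comment> \<open>Along a walk from the root, a step out of \<open>r\<close> enters the branch of
    a child, and a step that avoids \<open>r\<close> stays in its branch.\<close>
  have in_branch: "v = r \<or> v \<in> (\<Union>c\<in>?C. ?D c)" if "v \<in> verts G" for v
    using 1(5)[OF that]
  proof (induction rule: rtrancl_induct)
    case (step v w)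
    show ?case
    proof (cases "w = r \<or> v = r")
      case True
      then show ?thesis using step(2) D_self by (auto simp: root_children_def)
    next
      case False
      with step show ?thesis using D_closed by blast
    qed
  qed simp
  have verts: "verts G = insert r (\<Union>c\<in>?C. ?D c)"
    using in_branch 1(4) descendants_subset[of G r] by blast
  have branch: "Z_pairing (tree_I (descendant_subtree G r c) c) = det_on (?D c) (char_entry ?E)
      \<and> coeff (tree_I (descendant_subtree G r c) c) 0 = det_on (?D c - {c}) (char_entry ?E)"
    if c: "c \<in> ?C" for c
  proof -
    let ?H = "descendant_subtree G r c"
    have ends: "arcs_ends ?H = Restr ?E (?D c)" and vertsH: "verts ?H = ?D c"
      by (simp_all add: descendant_subtree_def arcs_ends_induce)
    \<comment> \<open>A walk off \<open>r\<close> that starts at \<open>c\<close> never leaves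
      \<open>?D c\<close>, so it lies in the induced subgraph.\<close>
    have reach: "(c, v) \<in> (arcs_ends ?H)\<^sup>*" if "v \<in> verts ?H" for v
    proof -
      have "(c, v) \<in> ?R" using that desc[OF c] vertsH by auto
      then show ?thesis
      proof (induction rule: rtrancl_induct)
        case (step v w)
        then have "v \<in> ?D c" "w \<in> ?D c"
          using desc[OF c] by (auto intro: rtrancl_into_rtrancl)
        then show ?case using step ends by (auto intro: rtrancl_into_rtrancl)
      qed simp
    qed
    have "verts G \<noteq> {r}" using child[OF c] adj_in_verts by blast
    then have "Z_pairing (tree_I ?H c) = det_on (verts ?H) (char_entry (arcs_ends ?H))
       \<and> coeff (tree_I ?H c) 0 = det_on (verts ?H - {c}) (char_entry (arcs_ends ?H))"
      using 1(2,4) reach tree_I_guard[OF 1(2) c] unique_branches_subset[OF 1(3)] ends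
      by (intro 1(1) c) auto
    moreover have "det_on S (char_entry (arcs_ends ?H)) = det_on S (char_entry ?E)"
      if "S \<subseteq> ?D c" for S
      by (rule det_on_cong) (use that in \<open>auto simp: char_entry_def ends\<close>)
    ultimately show ?thesis using vertsH by auto
  qed
  \<comment> \<open>The single-vertex case is thereby the empty product, so one formula serves both
    cases of \<open>tree_I\<close>.\<close>
  have "?C = {}" if "verts G = {r}"
  proof (rule equals0I)
    fix c assume "c \<in> ?C"
    from child[OF this] adj_in_verts(2)[OF child(1)[OF this]] that show False by simp
  qed
  then have tree_I: "tree_I G r = (\<Prod>c\<in>?C. e_op (tree_I (descendant_subtree G r c) c))"
    using 1(2,4) by (simp add: tree_I.simps[of G r])
  have "Z_pairing (tree_I G r) = det_on (insert r (\<Union>c\<in>?C. ?D c)) (char_entry ?E)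
      \<and> coeff (tree_I G r) 0 = det_on (\<Union>c\<in>?C. ?D c) (char_entry ?E)"
    unfolding tree_I
  proof (rule star_of_branches, goal_cases)
    case 1
    have "?C \<subseteq> verts G" by (auto simp: root_children_def)
    then show ?case by (rule finite_subset) (rule finite_verts)
  next
    case (2 c)
    show ?case by (rule finite_subset[OF descendants_subset finite_verts])
  next
    case (3 c)
    then show ?case by (rule D_self)
  next
    case (4 c)
    then show ?case by (rule D_not_root)
  next
    case (5 c d)
    then show ?case using D_same by blast
  next
    case (6 c d u v)
    then have "(u, v) \<notin> ?R" using D_same by blast
    then have "u \<noteq> v" "(u, v) \<notin> Restr ?E (- {r})" by auto
    then show ?case using 6 D_not_root by (auto simp: char_entry_def)
  next
    case (7 c v)
    \<comment> \<open>A neighbour \<open>v\<close> of \<open>r\<close> is a child and lies in its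
      own branch; lying in \<open>?D c\<close> too would force \<open>v = c\<close>.\<close>
    have "(r, v) \<notin> ?E"
    proof
      assume "(r, v) \<in> ?E"
      then have "v \<in> ?C" by (simp add: root_children_def)
      then show False using 7 D_same[of c v v v] D_self by blast
    qed
    moreover then have "(v, r) \<notin> ?E" using arcs_ends_symmetric[OF sym_arcs] by blast
    ultimately show ?case using 7 D_not_root by (auto simp: char_entry_def)
  next
    case (8 c)
    then show ?case using child[OF 8] by (auto simp: char_entry_def)
  next
    case 9
    show ?case by (simp add: char_entry_def)
  qed (use branch in auto)
  moreover have "verts G - {r} = (\<Union>c\<in>?C. ?D c)"
    using verts D_not_root by auto
  ultimately show ?case using verts by simp
qed

theorem theorem4:
  fixes T :: "('a, 'b) pre_digraph" and r :: 'a and vs :: "'a list"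
  assumes "undirected_tree T" and "r \<in> verts T"
    and "distinct vs" and "set vs = verts T"
  shows "Z_pairing (tree_I T r) = char_poly (adjacency_matrix T vs)"
proof -
  have "graph T" using assms(1) by (simp add: undirected_tree_def)
  then show ?thesis
    using tree_I_eq_det_on[of T r] undirected_tree_unique_branches[OF assms(1)]
      undirected_tree_reachable[OF assms(1,2)] char_poly_adjacency_matrix[OF _ assms(3,4)] assms(2)
    by simp
qed

end
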